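(* Let $b$ be a real number with $b\ge b'>0$ and such that $e:=b-\frac{1}{p-1}>0$. Then for every $\rho\in\mathbb{R}$, \[\mathcal{K}(b',b;\rho)=\mathcal{V}(b',b;\rho)\oplus D_a\,\mathcal{K}(b',b;\rho+e),\] and \[\mathcal{K}(b',b)=\mathcal{V}(b',b)\oplus D_a\,\mathcal{K}(b',b).\] Furthermore, $D_a$ is injective on $\mathcal{K}(b',b)$.
   Context: Let $p\ge5$ be prime, $d$ a positive integer with $p\nmid d$, $\mathrm{ord}$ the $p$-adic valuation on $\mathbb{C}_p$ normalized by $\mathrm{ord}(p)=1$, and fix $\pi\in\mathbb{C}_p$ with $\pi^{p-1}=-p$. Let $b\ge b'>0$ be reals. For $\rho\in\mathbb{R}$ define $L(b';\rho):=\{\sum_{i\ge0}B_ia^i: B_i\in\mathbb{C}_p,\ \mathrm{ord}(B_i)\ge b'(1-1/d)i+\rho\ \forall i\}$, $L(b'):=\bigcup_\rho L(b';\rho)$; $\mathcal{K}(b',b;\rho):=\{\sum_{i,j\ge0}B_{ij}a^ix^j: \mathrm{ord}(B_{ij})\ge b'(1-1/d)i+bj/d+\rho\ \forall i,j\}$, $\mathcal{K}(b',b):=\bigcup_\rho\mathcal{K}(b',b;\rho)$; $\mathcal{V}(b',b;\rho):=\left(\bigoplus_{i=0}^{d-1}L(b';\rho)x^i\right)\cap\mathcal{K}(b',b;\rho)$, $\mathcal{V}(b',b):=\bigcup_\rho\mathcal{V}(b',b;\rho)$. Define the $L(b')$-linear operator $D_a:=x\frac{\partial}{\partial x}+\pi(dx^d+ax)$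 on $\mathcal{K}(b',b)$ (multiplication by $\pi(dx^d+ax)$ plus $x\,\partial/\partial x$, with $a$ treated as a constant). *)

theory Defs
  imports
    Complex_Main
    "HOL-Library.Extended_Real"
    "HOL-Computational_Algebra.Polynomial"
    "HOL-Computational_Algebra.Formal_Power_Series"
begin

text \<open>
  The libraries contain no field of $p$-adic complex numbers, so $\mathbb{C}_p$ is specified
  rather than constructed: \<open>is_Cp p ord\<close> says that the ambient field \<open>'k\<close>, with the
  additive valuation \<open>ord\<close> (where \<open>ord 0 = \<infinity>\<close>), is the completion of an algebraic closure of
  $\mathbb{Q}_p$, normalized by \<open>ord p = 1\<close>. This determines \<open>('k, ord)\<close> up to isometric
  isomorphism.
\<close>

definition ord_closure :: "('k::field \<Rightarrow> ereal) \<Rightarrow> 'k set \<Rightarrow> 'k set" where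
  "ord_closure ord S = {x. \<forall>C::real. \<exists>y\<in>S. ord (x - y) \<ge> ereal C}"

definition ord_complete :: "('k::field \<Rightarrow> ereal) \<Rightarrow> bool" where
  "ord_complete ord \<longleftrightarrow>
     (\<forall>s::nat \<Rightarrow> 'k.
        (\<forall>C::real. \<exists>N. \<forall>m\<ge>N. \<forall>n\<ge>N. ord (s m - s n) \<ge> ereal C) \<longrightarrow>
        (\<exists>l. \<forall>C::real. \<exists>N. \<forall>n\<ge>N. ord (s n - l) \<ge> ereal C))"

text \<open>
  Inside a complete field, the completion $\mathbb{Q}_p$ of $\mathbb{Q}$ is the closure of the
  prime field. That \<open>ord\<close> restricts to the $p$-adic valuation of $\mathbb{Q}$ follows from the
  valuation axioms and \<open>ord p = 1\<close>.
\<close>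

definition Qp_in :: "('k::field_char_0 \<Rightarrow> ereal) \<Rightarrow> 'k set" where
  "Qp_in ord = ord_closure ord (range of_rat)"

definition Qp_bar_in :: "('k::field_char_0 \<Rightarrow> ereal) \<Rightarrow> 'k set" where
  "Qp_bar_in ord =
     {x. \<exists>q. q \<noteq> 0 \<and> (\<forall>n. coeff q n \<in> Qp_in ord) \<and> poly q x = 0}"

definition is_Cp :: "nat \<Rightarrow> ('k::field_char_0 \<Rightarrow> ereal) \<Rightarrow> bool" where
  "is_Cp p ord \<longleftrightarrow>
     (\<forall>x. ord x = \<infinity> \<longleftrightarrow> x = 0) \<and>
     (\<forall>x. ord x \<noteq> -\<infinity>) \<and>
     (\<forall>x y. ord (x * y) = ord x + ord y) \<and>
     (\<forall>x y. ord (x + y) \<ge> min (ord x) (ord y)) \<and>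
     ord (of_nat p) = 1 \<and>
     ord_complete ord \<and>
     (\<forall>q. degree q > 0 \<and> (\<forall>n. coeff q n \<in> Qp_bar_in ord) \<longrightarrow>
        (\<exists>x\<in>Qp_bar_in ord. poly q x = 0)) \<and>
     ord_closure ord (Qp_bar_in ord) = UNIV"

text \<open>
  A series in $a$ is an element of \<open>'k fps\<close>. A series $\sum B_{ij} a^i x^j$ is an element of
  \<open>'k fps fps\<close>, the outer variable being $x$ and the inner one $a$, so that
  \<open>B\<^sub>i\<^sub>j = f $ j $ i\<close>.
\<close>

definition L_rho :: "('k::field_char_0 \<Rightarrow> ereal) \<Rightarrow> nat \<Rightarrow> real \<Rightarrow> real \<Rightarrow> 'k fps set" where
  "L_rho ord d b' \<rho> =
     {f. \<forall>i. ord (fps_nth f i) \<ge> ereal (b' * (1 - 1 / real d) * real i + \<rho>)}"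

definition L_space :: "('k::field_char_0 \<Rightarrow> ereal) \<Rightarrow> nat \<Rightarrow> real \<Rightarrow> 'k fps set" where
  "L_space ord d b' = (\<Union>\<rho>. L_rho ord d b' \<rho>)"

definition K_rho ::
  "('k::field_char_0 \<Rightarrow> ereal) \<Rightarrow> nat \<Rightarrow> real \<Rightarrow> real \<Rightarrow> real \<Rightarrow> 'k fps fps set" where
  "K_rho ord d b' b \<rho> =
     {f. \<forall>i j. ord (fps_nth (fps_nth f j) i)
               \<ge> ereal (b' * (1 - 1 / real d) * real i + b * real j / real d + \<rho>)}"

definition K_space ::
  "('k::field_char_0 \<Rightarrow> ereal) \<Rightarrow> nat \<Rightarrow> real \<Rightarrow> real \<Rightarrow> 'k fps fps set" where
  "K_space ord d b' b = (\<Union>\<rho>. K_rho ord d b' b \<rho>)"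

definition V_rho ::
  "('k::field_char_0 \<Rightarrow> ereal) \<Rightarrow> nat \<Rightarrow> real \<Rightarrow> real \<Rightarrow> real \<Rightarrow> 'k fps fps set" where
  "V_rho ord d b' b \<rho> =
     {\<Sum>i<d. fps_const (c i) * fps_X ^ i | c. \<forall>i<d. c i \<in> L_space ord d b'}
     \<inter> K_rho ord d b' b \<rho>"

definition V_space ::
  "('k::field_char_0 \<Rightarrow> ereal) \<Rightarrow> nat \<Rightarrow> real \<Rightarrow> real \<Rightarrow> 'k fps fps set" where
  "V_space ord d b' b = (\<Union>\<rho>. V_rho ord d b' b \<rho>)"

text \<open>
  The outer \<open>fps_X\<close> is $x$ and \<open>fps_const fps_X\<close> is $a$; \<open>fps_deriv\<close> is $\partial/\partial x$.
\<close>

definition D_a :: "'k::field_char_0 \<Rightarrow> nat \<Rightarrow> 'k fps fps \<Rightarrow> 'k fps fps" where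
  "D_a \<pi> d f =
     fps_X * fps_deriv f
     + fps_const (fps_const \<pi>) * (of_nat d * fps_X ^ d + fps_const fps_X * fps_X) * f"

definition add_subgroup :: "'g::ab_group_add set \<Rightarrow> bool" where
  "add_subgroup H \<longleftrightarrow> 0 \<in> H \<and> (\<forall>x\<in>H. \<forall>y\<in>H. x - y \<in> H)"

definition internal_direct_sum ::
  "'g::ab_group_add set \<Rightarrow> 'g set \<Rightarrow> 'g set \<Rightarrow> bool" where
  "internal_direct_sum M A B \<longleftrightarrow>
     add_subgroup A \<and> add_subgroup B \<and> A \<inter> B = {0} \<and> M = {u + w | u w. u \<in> A \<and> w \<in> B}"

end

theory Submission imports Defs begin

unbundle fps_syntax

text \<open>
  Let $f_{i,m}$ be the coefficient of $a^i x^m$. Then \<open>D_a f = v\<close>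
  modulo $1, x, \dots, x^{d-1}$ reads
  $\pi d\, f_{i,m} = v_{i,m+d} - (m+d) f_{i,m+d} - \pi f_{i-1,m+d-1}$.
  Ignoring the term $(m+d) f_{i,m+d}$, this is a recursion on the exponent \<open>i\<close> of $a$ (for every
  $d \ge 1$), and since \<open>b \<ge> b'\<close> its solution gains exactly \<open>e\<close> in the weight. The
  ignored term comes from $x\,\partial/\partial x$, which preserves the weight, so it is a
  contracting perturbation: successive approximation gives existence, and an element of
  the kernel modulo \<open>V\<close> has arbitrarily large weight, hence vanishes.
\<close>

section \<open>Valuations on a field of characteristic zero\<close>

locale valued_field =
  fixes ord :: "'k::field_char_0 \<Rightarrow> ereal"
  assumes ord_eq_infty_iff: "ord x = \<infinity> \<longleftrightarrow> x = 0"
    and ord_not_minfty: "ord x \<noteq> -\<infinity>"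
    and ord_mult: "ord (x * y) = ord x + ord y"
    and ord_add: "ord (x + y) \<ge> min (ord x) (ord y)"
begin

lemma ord_0 [simp]: "ord 0 = \<infinity>"
  by (simp add: ord_eq_infty_iff)

lemma ord_finite:
  assumes "x \<noteq> 0"
  obtains r where "ord x = ereal r"
  using assms ord_eq_infty_iff[of x] ord_not_minfty[of x] by (cases "ord x") auto

lemma ord_1 [simp]: "ord 1 = 0"
proof -
  obtain r where "ord 1 = ereal r"
    using ord_finite[of 1] by auto
  with ord_mult[of 1 1] show ?thesis
    by (simp add: zero_ereal_def)
qed

lemma ord_uminus [simp]: "ord (- x) = ord x"
proof -
  obtain r where r: "ord (-1) = ereal r"
    using ord_finite[of "-1"] by auto
  with ord_mult[of "-1" "-1"] have "ord (-1) = 0"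
    by (simp add: zero_ereal_def)
  with ord_mult[of "-1" x] show ?thesis
    by simp
qed

lemma ord_power:
  assumes "ord x = ereal r"
  shows "ord (x ^ n) = ereal (real n * r)"
  by (induction n) (simp_all add: ord_mult assms zero_ereal_def algebra_simps)

lemma ord_add_ge: "c \<le> ord x \<Longrightarrow> c \<le> ord y \<Longrightarrow> c \<le> ord (x + y)"
  by (meson min.boundedI ord_add order_trans)

lemma ord_diff_ge: "c \<le> ord x \<Longrightarrow> c \<le> ord y \<Longrightarrow> c \<le> ord (x - y)"
  using ord_add_ge[of c x "- y"] by simp

lemma ord_mult_ge:
  "ereal r \<le> ord x \<Longrightarrow> ereal s \<le> ord y \<Longrightarrow> ereal (r + s) \<le> ord (x * y)"
  by (metis add_mono ord_mult plus_ereal.simps(1))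

lemma ord_of_nat_nonneg: "0 \<le> ord (of_nat n)"
  by (induction n) (auto intro: ord_add_ge)

lemma ord_of_nat_mult_ge: "ereal r \<le> ord x \<Longrightarrow> ereal r \<le> ord (of_nat n * x)"
  using ord_mult_ge[of 0 "of_nat n" r x] ord_of_nat_nonneg[of n] by (simp add: zero_ereal_def)

lemma ord_divide_ge:
  assumes "ord y = ereal s" and "ereal r \<le> ord x"
  shows "ereal (r - s) \<le> ord (x / y)"
proof -
  have "y \<noteq> 0"
    using assms(1) by auto
  then have "ord x = ord (x / y) + ereal s"
    using ord_mult[of "x / y" y] assms(1) by simp
  with assms(2) show ?thesis
    by (cases "ord (x / y)") auto
qed

lemma eq_0_if_ord_large:
  assumes "\<And>C. ereal C \<le> ord x"
  shows "x = 0"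
proof (rule ccontr)
  assume "x \<noteq> 0"
  then obtain r where "ord x = ereal r"
    by (rule ord_finite)
  with assms[of "r + 1"] show False
    by simp
qed

text \<open>Bezout gives \<open>u n - v p = 1\<close>. If \<open>ord n\<close> were positive, both
  terms and hence \<open>1\<close> would have positive valuation.\<close>

lemma ord_of_nat_coprime:
  assumes "prime p" and "ord (of_nat p) = 1" and "\<not> p dvd n"
  shows "ord (of_nat n) = 0"
proof (rule ccontr)
  assume neq: "ord (of_nat n) \<noteq> 0"
  obtain u v where uv: "n * u = Suc (p * v)"
    using bezout_prime[OF assms(1,3)] by blast
  have "n \<noteq> 0"
    using assms(3) by (metis dvd_0_right)
  then obtain r where r: "ord (of_nat n) = ereal r"
    using ord_finite[of "of_nat n"] by auto
  with neq ord_of_nat_nonneg[of n] have "r > 0"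
    by (simp add: zero_ereal_def)
  \<comment> \<open>A common positive lower bound for the valuations of \<open>n\<close> and
    \<open>p\<close>.\<close>
  define s where "s = min r 1"
  have "ereal s \<le> ord (of_nat u * of_nat n)"
    by (rule ord_of_nat_mult_ge) (simp add: r s_def)
  moreover have "ereal s \<le> ord (of_nat v * of_nat p)"
    by (rule ord_of_nat_mult_ge) (simp add: assms(2) s_def one_ereal_def)
  ultimately have "ereal s \<le> ord (of_nat u * of_nat n - of_nat v * of_nat p)"
    by (rule ord_diff_ge)
  moreover have "(of_nat u * of_nat n - of_nat v * of_nat p :: 'k) = 1"
    using arg_cong[OF uv, of "of_nat :: nat \<Rightarrow> 'k"] by (simp add: mult.commute)
  ultimately show False
    using \<open>r > 0\<close> by (simp add: s_def zero_ereal_def min_def split: if_splits)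
qed

section \<open>The filtration by the spaces \<open>K_rho\<close>: separated and complete\<close>

lemma K_rho_iff:
  "f \<in> K_rho ord d b' b \<rho> \<longleftrightarrow>
     (\<forall>i j. ereal (b' * (1 - 1 / real d) * real i + b * real j / real d + \<rho>) \<le> ord (f $ j $ i))"
  by (simp add: K_rho_def)

lemma zero_in_K_rho: "0 \<in> K_rho ord d b' b \<rho>"
  by (simp add: K_rho_iff)

lemma diff_in_K_rho:
  "f \<in> K_rho ord d b' b \<rho> \<Longrightarrow> g \<in> K_rho ord d b' b \<rho> \<Longrightarrow> f - g \<in> K_rho ord d b' b \<rho>"
  by (auto simp: K_rho_iff intro: ord_diff_ge)

lemma add_in_K_rho:
  "f \<in> K_rho ord d b' b \<rho> \<Longrightarrow> g \<in> K_rho ord d b' b \<rho> \<Longrightarrow> f + g \<in> K_rho ord d b' b \<rho>"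
  by (auto simp: K_rho_iff intro: ord_add_ge)

lemma K_rho_antimono:
  assumes "\<rho> \<le> \<sigma>"
  shows "K_rho ord d b' b \<sigma> \<subseteq> K_rho ord d b' b \<rho>"
proof
  fix f assume f: "f \<in> K_rho ord d b' b \<sigma>"
  show "f \<in> K_rho ord d b' b \<rho>"
    unfolding K_rho_iff
  proof (intro allI)
    fix i j
    have "ereal (b' * (1 - 1 / real d) * real i + b * real j / real d + \<rho>)
        \<le> ereal (b' * (1 - 1 / real d) * real i + b * real j / real d + \<sigma>)"
      using assms by simp
    also have "\<dots> \<le> ord (f $ j $ i)"
      using f by (simp add: K_rho_iff)
    finally show "ereal (b' * (1 - 1 / real d) * real i + b * real j / real d + \<rho>)
        \<le> ord (f $ j $ i)" .
  qed
qed

text \<open>The Euler operator multiplies the coefficient of \<open>x^j\<close> by the natural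
  number \<open>j\<close>, whose valuation is nonnegative.\<close>

lemma euler_in_K_rho:
  assumes "f \<in> K_rho ord d b' b \<rho>"
  shows "fps_X * fps_deriv f \<in> K_rho ord d b' b \<rho>"
proof -
  have "(fps_X * fps_deriv f) $ j $ i = of_nat j * f $ j $ i" for i j
    by (cases j) (simp_all add: fps_of_nat[symmetric] del: of_nat_Suc)
  then show ?thesis
    using assms by (auto simp: K_rho_iff intro: ord_of_nat_mult_ge)
qed

text \<open>The filtration is separated: at each fixed monomial the lower bounds are unbounded in
  \<open>n\<close>.\<close>

lemma eq_0_if_in_all_K_rho:
  assumes "e > 0" and "\<And>n::nat. f \<in> K_rho ord d b' b (\<rho> + real n * e)"
  shows "f = 0"
proof -
  have "f $ j $ i = 0" for i j
  proof (rule eq_0_if_ord_large)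
    fix C :: real
    define w where "w = b' * (1 - 1 / real d) * real i + b * real j / real d"
    obtain n where n: "C - w - \<rho> < real n * e"
      using reals_Archimedean3[OF assms(1)] by blast
    have "ereal C \<le> ereal (w + (\<rho> + real n * e))"
      using n by simp
    also have "\<dots> \<le> ord (f $ j $ i)"
      using assms(2)[of n] by (simp add: K_rho_iff w_def)
    finally show "ereal C \<le> ord (f $ j $ i)" .
  qed
  then show ?thesis
    by (simp add: fps_eq_iff)
qed

text \<open>Limits are taken coefficient by coefficient, with no uniformity in \<open>i\<close> and
  \<open>j\<close>. The ultrametric inequality still gives one explicit rate for all
  monomials.\<close>

lemma K_rho_complete:
  assumes complete: "ord_complete ord" and "e > 0"
    and step: "\<And>n::nat. f (Suc n) - f n \<in> K_rho ord d b' b (\<rho> + real n * e)"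
  obtains F where "\<And>n. F - f n \<in> K_rho ord d b' b (\<rho> + real n * e)"
proof -
  define w where "w i j = b' * (1 - 1 / real d) * real i + b * real j / real d" for i j :: nat
  \<comment> \<open>Telescoping: the bound for step \<open>n\<close> is the weakest of those from
    \<open>n\<close> to \<open>m\<close>, and ultrametric sums lose nothing.\<close>
  have diff: "f m - f n \<in> K_rho ord d b' b (\<rho> + real n * e)" if "n \<le> m" for m n
    using that
  proof (induction m rule: dec_induct)
    case base
    show ?case by (simp add: zero_in_K_rho)
  next
    case (step m)
    have "\<rho> + real n * e \<le> \<rho> + real m * e"
      using step \<open>e > 0\<close> by simp
    then have "f (Suc m) - f m \<in> K_rho ord d b' b (\<rho> + real n * e)"
      using assms(3)[of m] K_rho_antimono by blast
    from add_in_K_rho[OF this step.IH] show ?case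
      by simp
  qed
  then have diff_ord: "ereal (w i j + (\<rho> + real n * e)) \<le> ord (f m $ j $ i - f n $ j $ i)"
    if "n \<le> m" for i j m n
    using that unfolding K_rho_iff w_def by (metis fps_sub_nth)
  have "\<exists>l. \<forall>C::real. \<exists>N. \<forall>n\<ge>N. ereal C \<le> ord (f n $ j $ i - l)" for i j
  proof -
    have "\<exists>N. \<forall>m\<ge>N. \<forall>n\<ge>N. ereal C \<le> ord (f m $ j $ i - f n $ j $ i)" for C :: real
    proof -
      obtain N where N: "C - w i j - \<rho> < real N * e"
        using reals_Archimedean3[OF \<open>e > 0\<close>] by blast
      have *: "ereal C \<le> ord (f m $ j $ i - f N $ j $ i)" if "m \<ge> N" for m
        by (rule order_trans[OF _ diff_ord[OF that]]) (use N in simp)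
      have "ereal C \<le> ord (f m $ j $ i - f n $ j $ i)" if "m \<ge> N" "n \<ge> N" for m n
        using ord_diff_ge[OF *[OF that(1)] *[OF that(2)]] by simp
      then show ?thesis by blast
    qed
    with complete[unfolded ord_complete_def, rule_format, of "\<lambda>n. f n $ j $ i"] show ?thesis
      by blast
  qed
  then have "\<forall>i j. \<exists>l. \<forall>C::real. \<exists>N. \<forall>n\<ge>N. ereal C \<le> ord (f n $ j $ i - l)"
    by blast
  then obtain l where l: "\<And>i j C. \<exists>N. \<forall>n\<ge>N. ereal C \<le> ord (f n $ j $ i - l i j)"
    unfolding choice_iff by blast
  define F where "F = Abs_fps (\<lambda>j. Abs_fps (\<lambda>i. l i j))"
  have "F - f n \<in> K_rho ord d b' b (\<rho> + real n * e)" for n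
    unfolding K_rho_iff
  proof (intro allI)
    fix i j
    obtain N where N: "\<forall>m\<ge>N. ereal (w i j + (\<rho> + real n * e)) \<le> ord (f m $ j $ i - l i j)"
      using l by blast
    \<comment> \<open>\<open>N\<close> depends on the monomial, but \<open>m\<close> only mediates
      between \<open>f n\<close> and the limit and is absent from the resulting bound.\<close>
    define m where "m = max N n"
    have "ereal (w i j + (\<rho> + real n * e))
        \<le> ord ((f m $ j $ i - f n $ j $ i) - (f m $ j $ i - l i j))"
      by (rule ord_diff_ge) (use N diff_ord in \<open>simp_all add: m_def\<close>)
    then show "ereal (b' * (1 - 1 / real d) * real i + b * real j / real d + (\<rho> + real n * e))
        \<le> ord ((F - f n) $ j $ i)"
      by (simp add: F_def w_def)
  qed
  with that show thesis by blast
qed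

text \<open>Membership of the coefficients in \<open>L_space\<close> is automatic: the
  \<open>K_rho\<close> bound at fixed \<open>j\<close> is an \<open>L_rho\<close> bound with
  \<open>\<rho>\<close> shifted by \<open>b j / d\<close>. What remains is a degree
  condition.\<close>

lemma V_rho_iff:
  "f \<in> V_rho ord d b' b \<rho> \<longleftrightarrow> f \<in> K_rho ord d b' b \<rho> \<and> (\<forall>j\<ge>d. f $ j = 0)"
proof -
  have coeff: "(\<Sum>i<d. fps_const (c i) * fps_X ^ i) $ j = (if j < d then c j else 0)"
    for c :: "nat \<Rightarrow> 'k fps" and j
    by (simp add: fps_sum_nth fps_X_power_nth if_distrib[of "\<lambda>x. _ * x"] cong: if_cong)
  have "\<exists>c. f = (\<Sum>i<d. fps_const (c i) * fps_X ^ i) \<and> (\<forall>i<d. c i \<in> L_space ord d b')"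
    if f: "f \<in> K_rho ord d b' b \<rho>" and "\<forall>j\<ge>d. f $ j = 0"
  proof (intro exI conjI allI impI)
    show "f = (\<Sum>i<d. fps_const (f $ i) * fps_X ^ i)"
      using that(2) by (simp add: fps_eq_iff[of f] coeff)
    fix j
    have "f $ j \<in> L_rho ord d b' (b * real j / real d + \<rho>)"
      using f by (simp add: K_rho_iff L_rho_def add.assoc)
    then show "f $ j \<in> L_space ord d b'"
      by (auto simp: L_space_def)
  qed
  then show ?thesis
    by (auto simp: V_rho_def coeff)
qed

lemma add_subgroup_K_rho: "add_subgroup (K_rho ord d b' b \<rho>)"
  by (simp add: add_subgroup_def zero_in_K_rho diff_in_K_rho)

lemma add_subgroup_V_rho: "add_subgroup (V_rho ord d b' b \<rho>)"
  by (simp add: add_subgroup_def V_rho_iff zero_in_K_rho diff_in_K_rho)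

lemma V_rho_antimono: "\<rho> \<le> \<sigma> \<Longrightarrow> V_rho ord d b' b \<sigma> \<subseteq> V_rho ord d b' b \<rho>"
  using K_rho_antimono[of \<rho> \<sigma> d b' b] by (auto simp: V_rho_iff)

end

text \<open>Any two elements of the union already lie in one member, the one at the smaller
  index.\<close>

lemma add_subgroup_UN_antimono:
  fixes A :: "real \<Rightarrow> 'g::ab_group_add set"
  assumes "\<And>\<rho>. add_subgroup (A \<rho>)" and "\<And>\<rho> \<sigma>. \<rho> \<le> \<sigma> \<Longrightarrow> A \<sigma> \<subseteq> A \<rho>"
  shows "add_subgroup (\<Union>\<rho>. A \<rho>)"
  unfolding add_subgroup_def
proof (intro conjI ballI)
  show "0 \<in> (\<Union>\<rho>. A \<rho>)"
    using assms(1) by (auto simp: add_subgroup_def)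
  fix x y assume "x \<in> (\<Union>\<rho>. A \<rho>)" "y \<in> (\<Union>\<rho>. A \<rho>)"
  then obtain \<rho> \<sigma> where "x \<in> A \<rho>" "y \<in> A \<sigma>"
    by blast
  then have "x \<in> A (min \<rho> \<sigma>)" "y \<in> A (min \<rho> \<sigma>)"
    using assms(2)[of "min \<rho> \<sigma>" \<rho>] assms(2)[of "min \<rho> \<sigma>" \<sigma>] by auto
  then have "x - y \<in> A (min \<rho> \<sigma>)"
    using assms(1) by (auto simp: add_subgroup_def)
  then show "x - y \<in> (\<Union>\<rho>. A \<rho>)"
    by blast
qed

section \<open>Coefficients of \<open>D_a\<close> and division by its multiplication part\<close>

lemma D_a_diff: "D_a \<pi> d (f - g) = D_a \<pi> d f - D_a \<pi> d g"
  by (simp add: D_a_def algebra_simps)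

lemma D_a_0 [simp]: "D_a \<pi> d 0 = 0"
  by (simp add: D_a_def)

lemma add_subgroup_D_a_image:
  assumes "add_subgroup H"
  shows "add_subgroup (D_a \<pi> d ` H)"
proof -
  have "0 \<in> D_a \<pi> d ` H"
    using assms by (metis D_a_0 add_subgroup_def imageI)
  then show ?thesis
    using assms by (auto simp: add_subgroup_def D_a_diff[symmetric])
qed

lemma D_a_nth:
  "D_a \<pi> d f $ j $ i =
     of_nat j * f $ j $ i + \<pi> * of_nat d * (if j < d then 0 else f $ (j - d) $ i)
     + \<pi> * (if i = 0 \<or> j = 0 then 0 else f $ (j - 1) $ (i - 1))"
proof -
  \<comment> \<open>Each summand is now a scalar times a monomial shift, so its coefficients can be
    read off.\<close>
  have D: "D_a \<pi> d f = fps_X * fps_deriv f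
      + fps_const (fps_const (\<pi> * of_nat d)) * (fps_X ^ d * f)
      + fps_const (fps_const \<pi> * fps_X) * (fps_X * f)"
    by (simp add: D_a_def algebra_simps fps_of_nat[symmetric]
        flip: fps_const_mult)
  show ?thesis
    unfolding D
    by (cases j) (simp_all add: fps_X_power_mult_nth mult.assoc fps_of_nat[symmetric]
        del: of_nat_Suc fps_const_mult)
qed

text \<open>In degree \<open>m + d > 0\<close> both case distinctions on the exponent of
  \<open>x\<close> disappear, leaving only the one on \<open>i\<close>.\<close>

lemma D_a_nth_add:
  assumes "d > 0"
  shows "D_a \<pi> d f $ (m + d) $ i =
     of_nat (m + d) * f $ (m + d) $ i + \<pi> * of_nat d * f $ m $ i
     + \<pi> * (if i = 0 then 0 else f $ (m + d - 1) $ (i - 1))"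
  using assms by (simp add: D_a_nth)

text \<open>The recursion must run on the exponent of \<open>a\<close>: the index
  \<open>m + d - 1\<close> in the recursive call is never below \<open>m\<close>.\<close>

primrec quot_coeff :: "'k::field_char_0 \<Rightarrow> nat \<Rightarrow> 'k fps fps \<Rightarrow> nat \<Rightarrow> nat \<Rightarrow> 'k" where
  "quot_coeff \<pi> d h 0 m = h $ (m + d) $ 0 / (\<pi> * of_nat d)"
| "quot_coeff \<pi> d h (Suc i) m =
     (h $ (m + d) $ Suc i - \<pi> * quot_coeff \<pi> d h i (m + d - 1)) / (\<pi> * of_nat d)"

text \<open>The quotient of $h$ by $\pi (d x^d + a x)$, the remainder having degree less than $d$ in $x$.\<close>

definition quot :: "'k::field_char_0 \<Rightarrow> nat \<Rightarrow> 'k fps fps \<Rightarrow> 'k fps fps" where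
  "quot \<pi> d h = Abs_fps (\<lambda>m. Abs_fps (\<lambda>i. quot_coeff \<pi> d h i m))"

text \<open>The recursion cleared of denominators, in the shape required by
  \<open>quotient_bound\<close>.\<close>

lemma quot_nth:
  assumes "\<pi> \<noteq> 0" and "d > 0"
  shows "\<pi> * of_nat d * quot \<pi> d h $ m $ i =
    h $ (m + d) $ i - \<pi> * (if i = 0 then 0 else quot \<pi> d h $ (m + d - 1) $ (i - 1))"
  using assms by (cases i) (simp_all add: quot_def)

section \<open>Weight estimates for \<open>D_a\<close>, with \<open>c\<close> the valuation of
  \<open>\<pi>\<close>\<close>

locale dwork_operator = valued_field ord
  for ord :: "'k::field_char_0 \<Rightarrow> ereal" +
  fixes \<pi> :: 'k and d :: nat and b b' c e :: real
  assumes complete: "ord_complete ord"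
    and ord_pi: "ord \<pi> = ereal c"
    and d_pos: "d > 0" and ord_d: "ord (of_nat d) = 0"
    and b_ge: "b \<ge> b'" and e_eq: "e = b - c" and e_pos: "e > 0"
begin

abbreviation K where "K \<equiv> K_rho ord d b' b"
abbreviation V where "V \<equiv> V_rho ord d b' b"
abbreviation D where "D \<equiv> D_a \<pi> d"

definition wt :: "nat \<Rightarrow> nat \<Rightarrow> real" where
  "wt i j = b' * (1 - 1 / real d) * real i + b * real j / real d"

lemma K_iff: "f \<in> K \<rho> \<longleftrightarrow> (\<forall>i j. ereal (wt i j + \<rho>) \<le> ord (f $ j $ i))"
  by (simp add: K_rho_iff wt_def)

lemma pi_nonzero: "\<pi> \<noteq> 0"
  using ord_pi by auto

lemma wt_add_d: "wt i (m + d) = wt i m + b"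
  using d_pos by (simp add: wt_def field_simps)

text \<open>Multiplication by \<open>a x\<close> adds \<open>b' (1 - 1/d) + b/d\<close> to the
  weight. This is at most \<open>b\<close> because \<open>b' \<le> b\<close>.\<close>

lemma wt_diagonal: "wt (Suc i) (Suc j) \<le> wt i j + b"
proof -
  have "b' * (1 - 1 / real d) \<le> b * (1 - 1 / real d)"
    using b_ge d_pos by (intro mult_right_mono) auto
  then show ?thesis
    by (simp add: wt_def algebra_simps add_divide_distrib)
qed

text \<open>Each step of the division recursion moves from \<open>(i + 1, m)\<close> to
  \<open>(i, m + d - 1)\<close>; since the weight does not drop, the gain \<open>e\<close> survives
  the induction.\<close>

lemma wt_lower: "wt (Suc i) m \<le> wt i (m + d - 1)"
  using wt_diagonal[of i "m + d - 1"] wt_add_d[of "Suc i" m] d_pos by simp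

lemma ord_pi_d: "ord (\<pi> * of_nat d) = ereal c"
  by (simp add: ord_mult ord_pi ord_d)

text \<open>Shifting down by \<open>x^d\<close> gains \<open>b\<close> and dividing by
  \<open>\<pi> d\<close> costs \<open>c\<close>, a net gain of \<open>e\<close>. Arbitrary solutions
  \<open>q\<close> are allowed, so that the bound also applies to kernel elements and to differences
  of approximations.\<close>

lemma quotient_bound:
  assumes h: "h \<in> K \<rho>"
    and q: "\<And>m i. \<pi> * of_nat d * q $ m $ i =
      h $ (m + d) $ i - \<pi> * (if i = 0 then 0 else q $ (m + d - 1) $ (i - 1))"
  shows "q \<in> K (\<rho> + e)"
proof -
  have shift: "wt i (m + d) + \<rho> - c = wt i m + (\<rho> + e)" for i m
    by (simp add: wt_add_d e_eq)
  have "ereal (wt i m + (\<rho> + e)) \<le> ord (q $ m $ i)" for i m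
  proof (induction i arbitrary: m)
    case 0
    have "ereal (wt 0 (m + d) + \<rho>) \<le> ord (\<pi> * of_nat d * q $ m $ 0)"
      unfolding q using h by (simp add: K_iff)
    from ord_divide_ge[OF ord_pi_d this] show ?case
      using pi_nonzero d_pos by (simp add: shift)
  next
    case (Suc i)
    \<comment> \<open>The factor \<open>\<pi>\<close> contributes \<open>c\<close>, and
      \<open>c + e = b\<close>.\<close>
    have "ereal (wt i (m + d - 1) + \<rho> + b) \<le> ord (\<pi> * q $ (m + d - 1) $ i)"
      using ord_mult_ge[of c \<pi>, OF _ Suc.IH[of "m + d - 1"]]
      by (simp add: ord_pi e_eq algebra_simps)
    moreover have "ereal (wt (Suc i) (m + d) + \<rho>) \<le> ereal (wt i (m + d - 1) + \<rho> + b)"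
      using wt_lower[of i m] by (simp add: wt_add_d)
    ultimately have "ereal (wt (Suc i) (m + d) + \<rho>) \<le> ord (\<pi> * q $ (m + d - 1) $ i)"
      by (rule order_trans[rotated])
    moreover have "ereal (wt (Suc i) (m + d) + \<rho>) \<le> ord (h $ (m + d) $ Suc i)"
      using h by (simp add: K_iff)
    ultimately have "ereal (wt (Suc i) (m + d) + \<rho>) \<le> ord (\<pi> * of_nat d * q $ m $ Suc i)"
      unfolding q by (simp add: ord_diff_ge)
    from ord_divide_ge[OF ord_pi_d this] show ?case
      using pi_nonzero d_pos by (simp add: shift)
  qed
  then show ?thesis
    by (simp add: K_iff)
qed

text \<open>With the factor \<open>\<pi>\<close> the available gain is \<open>c + e = b\<close>,
  enough to pay for \<open>x^d\<close> and for \<open>a x\<close>. The Euler term even keeps the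
  bound \<open>\<rho> + e\<close>.\<close>

lemma D_maps_K:
  assumes "f \<in> K (\<rho> + e)"
  shows "D f \<in> K \<rho>"
proof -
  have f: "ereal (wt i j + \<rho> + e) \<le> ord (f $ j $ i)" for i j
    using assms by (simp add: K_iff add.assoc)
  have f_pi: "ereal (wt i j + \<rho> + b) \<le> ord (\<pi> * f $ j $ i)" for i j
    using ord_mult_ge[of c \<pi>, OF _ f] by (simp add: ord_pi e_eq algebra_simps)
  have "ereal (wt i j + \<rho>) \<le> ord (D f $ j $ i)" for i j
    unfolding D_a_nth
  proof (intro ord_add_ge)
    have "ereal (wt i j + \<rho>) \<le> ord (f $ j $ i)"
      by (rule order_trans[OF _ f]) (use e_pos in simp)
    then show "ereal (wt i j + \<rho>) \<le> ord (of_nat j * f $ j $ i)"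
      by (rule ord_of_nat_mult_ge)
    show "ereal (wt i j + \<rho>) \<le> ord (\<pi> * of_nat d * (if j < d then 0 else f $ (j - d) $ i))"
    proof (cases "j < d")
      case False
      then have "wt i j + \<rho> = wt i (j - d) + \<rho> + b"
        using wt_add_d[of i "j - d"] by simp
      then have "ereal (wt i j + \<rho>) \<le> ord (of_nat d * (\<pi> * f $ (j - d) $ i))"
        using ord_of_nat_mult_ge[OF f_pi[of i "j - d"], of d] by (simp only:)
      with False show ?thesis
        by (simp add: mult_ac)
    qed simp
    show "ereal (wt i j + \<rho>) \<le> ord (\<pi> * (if i = 0 \<or> j = 0 then 0 else f $ (j - 1) $ (i - 1)))"
    proof (cases "i = 0 \<or> j = 0")
      case False
      then have "ereal (wt i j + \<rho>) \<le> ereal (wt (i - 1) (j - 1) + \<rho> + b)"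
        using wt_diagonal[of "i - 1" "j - 1"] by simp
      from order_trans[OF this f_pi] False show ?thesis
        by simp
    qed auto
  qed
  then show ?thesis
    by (simp add: K_iff)
qed

text \<open>Here \<open>f\<close> is its own quotient for the right-hand side \<open>- x f'\<close>,
  so each use of \<open>quotient_bound\<close> raises its weight by \<open>e\<close>. This yields
  both the trivial intersection with \<open>V\<close> and injectivity.\<close>

lemma eq_0_if_D_in_V:
  assumes f: "f \<in> K \<sigma>" and Df: "\<And>j. j \<ge> d \<Longrightarrow> D f $ j = 0"
  shows "f = 0"
proof -
  have eq: "\<pi> * of_nat d * f $ m $ i = (- (fps_X * fps_deriv f)) $ (m + d) $ i
      - \<pi> * (if i = 0 then 0 else f $ (m + d - 1) $ (i - 1))" for m i
  proof -
    have "(fps_X * fps_deriv f) $ (m + d) $ i = of_nat (m + d) * f $ (m + d) $ i"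
      using d_pos by (simp add: fps_of_nat[symmetric] del: of_nat_Suc of_nat_add)
    moreover have "D f $ (m + d) $ i = 0"
      using Df[of "m + d"] by simp
    ultimately show ?thesis
      using D_a_nth_add[OF d_pos, of \<pi> f m i] by (simp only: fps_neg_nth) algebra
  qed
  have "f \<in> K (\<sigma> + real n * e)" for n
  proof (induction n)
    case 0
    show ?case using f by simp
  next
    case (Suc n)
    have "- (fps_X * fps_deriv f) \<in> K (\<sigma> + real n * e)"
      using diff_in_K_rho[OF zero_in_K_rho euler_in_K_rho[OF Suc]] by simp
    from quotient_bound[OF this eq] show ?case
      by (simp add: algebra_simps)
  qed
  with e_pos show ?thesis
    by (rule eq_0_if_in_all_K_rho)
qed

lemma D_in_V_imp_eq_0: "f \<in> K \<sigma> \<Longrightarrow> D f \<in> V \<rho> \<Longrightarrow> f = 0"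
  by (rule eq_0_if_D_in_V) (simp_all add: V_rho_iff)

section \<open>Existence by successive approximation\<close>

lemma D_solve:
  assumes g: "g \<in> K \<rho>"
  obtains f where "f \<in> K (\<rho> + e)" and "\<And>j. j \<ge> d \<Longrightarrow> D f $ j = g $ j"
proof -
  define E :: "'k fps fps \<Rightarrow> 'k fps fps" where "E f = fps_X * fps_deriv f" for f
  \<comment> \<open>A fixed point \<open>f = quot \<pi> d (g - E f)\<close> is exactly a solution of
    \<open>D f = g\<close> in degrees at least \<open>d\<close>.\<close>
  define s where "s = rec_nat 0 (\<lambda>_ f. quot \<pi> d (g - E f))"
  have s_Suc: "s (Suc n) = quot \<pi> d (g - E (s n))" and s_0: "s 0 = 0" for n
    by (simp_all add: s_def)
  have E_diff: "E (u - v) = E u - E v" for u v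
    by (simp add: E_def algebra_simps)
  have E_nth: "E u $ (m + d) $ i = of_nat (m + d) * u $ (m + d) $ i" for u m i
    using d_pos by (simp add: E_def fps_of_nat[symmetric] del: of_nat_Suc of_nat_add)
  have quot: "\<pi> * of_nat d * quot \<pi> d h $ m $ i =
      h $ (m + d) $ i - \<pi> * (if i = 0 then 0 else quot \<pi> d h $ (m + d - 1) $ (i - 1))" for h m i
    by (rule quot_nth[OF pi_nonzero d_pos])
  have if_diff: "(if P then 0 else u - v) = (if P then 0 else u) - (if P then 0 else v)"
    for P and u v :: 'k
    by simp
  have step: "s (Suc n) - s n \<in> K (\<rho> + e + real n * e)" for n
  proof (induction n)
    case 0
    show ?case
      using quotient_bound[OF g quot] by (simp add: s_Suc s_0 E_def)
  next
    case (Suc n)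
    have "E (s n - s (Suc n)) \<in> K (\<rho> + e + real n * e)"
      using diff_in_K_rho[OF zero_in_K_rho euler_in_K_rho[OF Suc]]
      by (simp add: E_def algebra_simps)
    \<comment> \<open>Subtracting two consecutive quotient equations cancels \<open>g\<close>; the
      difference is a quotient of \<open>E (s n - s (Suc n))\<close>.\<close>
    moreover have "\<pi> * of_nat d * (s (Suc (Suc n)) - s (Suc n)) $ m $ i =
      E (s n - s (Suc n)) $ (m + d) $ i - \<pi> *
        (if i = 0 then 0 else (s (Suc (Suc n)) - s (Suc n)) $ (m + d - 1) $ (i - 1))" for m i
      using quot[of "g - E (s n)" m i] quot[of "g - E (s (Suc n))" m i]
      unfolding s_Suc[symmetric] E_diff fps_sub_nth if_diff by algebra
    ultimately have "s (Suc (Suc n)) - s (Suc n) \<in> K (\<rho> + e + real n * e + e)"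
      by (rule quotient_bound)
    then show ?case
      by (simp add: algebra_simps)
  qed
  obtain F where F: "\<And>n. F - s n \<in> K (\<rho> + e + real n * e)"
    using K_rho_complete[where f = s, OF complete e_pos step] by blast
  have "F \<in> K (\<rho> + e)"
    using F[of 0] by (simp add: s_0)
  moreover have "D F $ j = g $ j" if "j \<ge> d" for j
  proof -
    define m where "m = j - d"
    have j: "j = m + d"
      using that by (simp add: m_def)
    have "D F $ j $ i = g $ j $ i" for i
    proof -
      have "D (s (Suc n)) $ j $ i = E (s (Suc n)) $ j $ i + g $ j $ i - E (s n) $ j $ i" for n
        using quot[of "g - E (s n)" m i] D_a_nth_add[OF d_pos, of \<pi> "s (Suc n)" m i]
        unfolding j s_Suc[symmetric] E_nth fps_sub_nth by algebra
      \<comment> \<open>The left side is independent of \<open>n\<close>, while both terms on the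
        right gain weight with \<open>n\<close>; this replaces a continuity argument for
        \<open>D\<close>.\<close>
      then have residual: "D F $ j $ i - g $ j $ i
          = (D (F - s (Suc n)) + E (s (Suc n) - s n)) $ j $ i" for n
        by (simp add: E_diff D_a_diff)
      have bound: "ereal (wt i j + (\<rho> + real n * e)) \<le> ord (D F $ j $ i - g $ j $ i)" for n
      proof -
        have "K (\<rho> + e + real n * e) \<subseteq> K (\<rho> + real n * e)"
          using e_pos by (intro K_rho_antimono) simp
        then have "E (s (Suc n) - s n) \<in> K (\<rho> + real n * e)"
          using euler_in_K_rho[OF step[of n]] by (auto simp: E_def)
        \<comment> \<open>The loss of \<open>e\<close> under \<open>D\<close> is covered by the
          extra \<open>e\<close> in the rate at index \<open>n + 1\<close>.\<close>
        moreover have "D (F - s (Suc n)) \<in> K (\<rho> + real n * e)"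
          using D_maps_K[of _ "\<rho> + e + real n * e"] F[of "Suc n"] e_pos
            K_rho_antimono[of "\<rho> + real n * e" "\<rho> + e + real n * e" d b' b]
          by (auto simp: algebra_simps)
        ultimately show ?thesis
          unfolding residual[of n] using add_in_K_rho K_iff by blast
      qed
      have "D F $ j $ i - g $ j $ i = 0"
      proof (rule eq_0_if_ord_large)
        fix C :: real
        obtain n where n: "C - wt i j - \<rho> < real n * e"
          using reals_Archimedean3[OF e_pos] by blast
        show "ereal C \<le> ord (D F $ j $ i - g $ j $ i)"
          by (rule order_trans[OF _ bound[of n]]) (use n in simp)
      qed
      then show ?thesis by simp
    qed
    then show ?thesis
      by (simp add: fps_eq_iff)
  qed
  ultimately show thesis
    by (rule that)
qed

section \<open>The direct sum decompositions and injectivity\<close>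

lemma K_rho_decomposition:
  "internal_direct_sum (K \<rho>) (V \<rho>) (D ` K (\<rho> + e))"
  unfolding internal_direct_sum_def
proof (intro conjI)
  show "add_subgroup (V \<rho>)" "add_subgroup (D ` K (\<rho> + e))"
    by (simp_all add: add_subgroup_V_rho add_subgroup_D_a_image add_subgroup_K_rho)
  then have "{0} \<subseteq> V \<rho> \<inter> D ` K (\<rho> + e)"
    by (simp add: add_subgroup_def)
  moreover have "V \<rho> \<inter> D ` K (\<rho> + e) \<subseteq> {0}"
    by (auto dest: D_in_V_imp_eq_0)
  ultimately show "V \<rho> \<inter> D ` K (\<rho> + e) = {0}"
    by blast
  show "K \<rho> = {u + w |u w. u \<in> V \<rho> \<and> w \<in> D ` K (\<rho> + e)}"
  proof (intro subset_antisym subsetI)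
    fix g assume g: "g \<in> K \<rho>"
    obtain f where f: "f \<in> K (\<rho> + e)" and eq: "\<And>j. j \<ge> d \<Longrightarrow> D f $ j = g $ j"
      using D_solve[OF g] by blast
    \<comment> \<open>The remainder has no terms of degree at least \<open>d\<close>, and
      \<open>D_maps_K\<close> keeps it in \<open>K \<rho>\<close>.\<close>
    have "g - D f \<in> V \<rho>"
      using diff_in_K_rho[OF g D_maps_K[OF f]] eq by (simp add: V_rho_iff)
    then show "g \<in> {u + w |u w. u \<in> V \<rho> \<and> w \<in> D ` K (\<rho> + e)}"
      using f by (intro CollectI exI[of _ "g - D f"] exI[of _ "D f"]) simp
  next
    fix g assume "g \<in> {u + w |u w. u \<in> V \<rho> \<and> w \<in> D ` K (\<rho> + e)}"
    then show "g \<in> K \<rho>"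
      by (auto simp: V_rho_iff intro!: add_in_K_rho D_maps_K)
  qed
qed

lemma add_subgroup_K_space: "add_subgroup (K_space ord d b' b)"
  unfolding K_space_def
  by (rule add_subgroup_UN_antimono[OF add_subgroup_K_rho K_rho_antimono])

lemma K_space_decomposition:
  "internal_direct_sum (K_space ord d b' b) (V_space ord d b' b) (D ` K_space ord d b' b)"
  unfolding internal_direct_sum_def
proof (intro conjI)
  show "add_subgroup (V_space ord d b' b)"
    unfolding V_space_def
    by (rule add_subgroup_UN_antimono[OF add_subgroup_V_rho V_rho_antimono])
  moreover show "add_subgroup (D ` K_space ord d b' b)"
    by (rule add_subgroup_D_a_image[OF add_subgroup_K_space])
  ultimately have "{0} \<subseteq> V_space ord d b' b \<inter> D ` K_space ord d b' b"
    by (simp add: add_subgroup_def)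
  moreover have "V_space ord d b' b \<inter> D ` K_space ord d b' b \<subseteq> {0}"
  proof
    fix x assume "x \<in> V_space ord d b' b \<inter> D ` K_space ord d b' b"
    then obtain f \<rho> \<sigma> where "x = D f" "f \<in> K \<sigma>" "D f \<in> V \<rho>"
      unfolding V_space_def K_space_def by blast
    then show "x \<in> {0}"
      using D_in_V_imp_eq_0[of f \<sigma> \<rho>] by simp
  qed
  ultimately show "V_space ord d b' b \<inter> D ` K_space ord d b' b = {0}"
    by blast
  show "K_space ord d b' b = {u + w |u w. u \<in> V_space ord d b' b \<and> w \<in> D ` K_space ord d b' b}"
  proof (intro subset_antisym subsetI)
    fix g assume "g \<in> K_space ord d b' b"
    then obtain \<rho> where "g \<in> K \<rho>"
      by (auto simp: K_space_def)
    moreover have "K \<rho> = {u + w |u w. u \<in> V \<rho> \<and> w \<in> D ` K (\<rho> + e)}"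
      using K_rho_decomposition[of \<rho>] unfolding internal_direct_sum_def by simp
    ultimately obtain u f where g: "g = u + D f" and "u \<in> V \<rho>" "f \<in> K (\<rho> + e)"
      by auto
    then have "u \<in> V_space ord d b' b" "f \<in> K_space ord d b' b"
      unfolding V_space_def K_space_def by blast+
    then show "g \<in> {u + w |u w. u \<in> V_space ord d b' b \<and> w \<in> D ` K_space ord d b' b}"
      unfolding g by (intro CollectI exI[of _ u] exI[of _ "D f"]) simp
  next
    fix g assume "g \<in> {u + w |u w. u \<in> V_space ord d b' b \<and> w \<in> D ` K_space ord d b' b}"
    then obtain u f \<rho> \<sigma> where g: "g = u + D f" and "u \<in> V \<rho>" "f \<in> K \<sigma>"
      unfolding V_space_def K_space_def by blast
    \<comment> \<open>Writing \<open>\<sigma>\<close> as \<open>(\<sigma> - e) + e\<close> makes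
      \<open>D_maps_K\<close> applicable; the union over all bounds absorbs the loss.\<close>
    then have "u \<in> K \<rho>" "D f \<in> K (\<sigma> - e)"
      by (simp_all add: V_rho_iff D_maps_K)
    then have "u \<in> K (min \<rho> (\<sigma> - e))" "D f \<in> K (min \<rho> (\<sigma> - e))"
      by (blast intro: subsetD[OF K_rho_antimono[OF min.cobounded1]]
          subsetD[OF K_rho_antimono[OF min.cobounded2]])+
    then have "g \<in> K (min \<rho> (\<sigma> - e))"
      unfolding g by (rule add_in_K_rho)
    then show "g \<in> K_space ord d b' b"
      unfolding K_space_def by blast
  qed
qed

lemma inj_on_D: "inj_on D (K_space ord d b' b)"
proof (rule inj_onI)
  fix f g assume "f \<in> K_space ord d b' b" "g \<in> K_space ord d b' b" and eq: "D f = D g"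
  then have "f - g \<in> K_space ord d b' b"
    using add_subgroup_K_space by (simp add: add_subgroup_def)
  then obtain \<rho> where "f - g \<in> K \<rho>"
    by (auto simp: K_space_def)
  then have "f - g = 0"
    by (rule eq_0_if_D_in_V) (simp add: D_a_diff eq)
  then show "f = g"
    by simp
qed

end

theorem theorem2p1:
  fixes ord :: "'k::field_char_0 \<Rightarrow> ereal" and \<pi> :: 'k
    and p d :: nat and b b' e :: real
  assumes "prime p" and "p \<ge> 5"
    and "d > 0" and "\<not> p dvd d"
    and "is_Cp p ord"
    and "\<pi> ^ (p - 1) = - of_nat p"
    and "b \<ge> b'" and "b' > 0"
    and "e = b - 1 / (real p - 1)" and "e > 0"
  shows
    "(\<forall>\<rho>::real. internal_direct_sum (K_rho ord d b' b \<rho>)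
                   (V_rho ord d b' b \<rho>) (D_a \<pi> d ` K_rho ord d b' b (\<rho> + e)))
     \<and> internal_direct_sum (K_space ord d b' b)
         (V_space ord d b' b) (D_a \<pi> d ` K_space ord d b' b)
     \<and> inj_on (D_a \<pi> d) (K_space ord d b' b)"
proof -
  interpret valued_field ord
    using assms(5) by unfold_locales (auto simp: is_Cp_def)
  have ord_p: "ord (of_nat p) = 1" and complete: "ord_complete ord"
    using assms(5) by (auto simp: is_Cp_def)
  have "\<pi> \<noteq> 0"
    using assms(2,6) by (auto simp: power_0_left)
  then obtain c where c: "ord \<pi> = ereal c"
    by (rule ord_finite)
  \<comment> \<open>Taking valuations in \<open>\<pi>^(p-1) = -p\<close> determines
    \<open>c\<close>.\<close>
  have "ereal (real (p - 1) * c) = 1"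
    using ord_power[OF c, of "p - 1"] by (simp only: assms(6) ord_uminus ord_p)
  moreover have "real (p - 1) = real p - 1"
    using assms(2) by (simp add: of_nat_diff)
  ultimately have "(real p - 1) * c = 1"
    by (simp only: one_ereal_def ereal.inject)
  then have c_eq: "c = 1 / (real p - 1)"
    using assms(2) by (simp add: field_simps)
  \<comment> \<open>With \<open>c = 1/(p-1)\<close> the two descriptions of \<open>e\<close> agree,
    and \<open>p\<close> not dividing \<open>d\<close> gives \<open>ord d = 0\<close>.\<close>
  interpret dwork_operator ord \<pi> d b b' c e
    using complete c c_eq assms ord_of_nat_coprime[OF assms(1) ord_p assms(4)]
    by unfold_locales auto
  show ?thesis
    using K_rho_decomposition K_space_decomposition inj_on_D by blast
qed

end
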